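(* Let $\mathbf{C}$ be a monoidal category with tensor unit $I$. Then restriction is a monad on $\mathbf{C}$ graded over the idempotent subunits, where monomorphisms representing the same subobject are not identified. That is, let $\mathbf{E}$ have as objects monomorphisms $s\colon S\rightarrowtail I$ in $\mathbf{C}$ with $s\otimes\mathrm{id}_S$ an isomorphism, and as morphisms $f\colon s\to t$ those morphisms $f$ of $\mathbf{C}$ with $s=t\circ f$. Then restriction, i.e. the functor $\mathbf{E}\to[\mathbf{C},\mathbf{C}]$ sending $s\colon S\rightarrowtail I$ to the endofunctor $(-)\otimes S$ and $f$ to the natural transformation $\mathrm{id}_{(-)}\otimes f$, is an $\mathbf{E}$-graded monad on $\mathbf{C}$.
   Context: A subunit in a monoidal category with tensor unit $I$ is a subobject of $I$, i.e. an equivalence class of monomorphisms into $I$, identified when they factor through each other. A subunit $s\colon S\rightarrowtail I$ is idempotent when $s\otimes\mathrm{id}_S\colon S\otimes S\to I\otimes S$ is an isomorphism. The tensor product on $\mathbf{E}$ is that of subunits: $s\colon S\rightarrowtail I$ and $t\colon T\rightarrowtail I$ have tensor product $\lambda_I\circ(s\otimes t)\colon S\otimes T\to I$ (with $\lambda$ the left unitor of $\mathbf{C}$), and the tensor unit is $\mathrm{id}_I$. For a category $\mathbf{C}$ and a monoidal category $(\mathbf{E},\otimes,1)$ with associator $\alpha$ and left and right unitors $\lambda,\rho$, write $[\mathbf{C},\mathbf{C}]$ for the monoidal category of endofunctors of $\mathbf{C}$ with $F\otimes G=G\circ F$. An $\mathbf{E}$-graded monad on $\mathbf{C}$ is a monoidal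 functor $T\colon\mathbf{E}\to[\mathbf{C},\mathbf{C}]$. More concretely, it consists of a functor $T\colon\mathbf{E}\to[\mathbf{C},\mathbf{C}]$, a natural transformation $\eta\colon\mathrm{id}_{\mathbf{C}}\Rightarrow T(1)$, and a natural transformation $\mu_{s,t}\colon T(t)\circ T(s)\Rightarrow T(s\otimes t)$ for every two objects $s,t$ of $\mathbf{E}$, such that for all $r,s,t$ in $\mathbf{E}$ and all objects $E$ of $\mathbf{C}$: $$T(\alpha_{r,s,t})_E\circ(\mu_{r\otimes s,t})_E\circ T(t)\big((\mu_{r,s})_E\big)=(\mu_{r,s\otimes t})_E\circ(\mu_{s,t})_{T(r)(E)},$$ $$T(\lambda_s)_E\circ(\mu_{1,s})_E\circ T(s)(\eta_E)=\mathrm{id}_{T(s)(E)},\qquad T(\rho_s)_E\circ(\mu_{s,1})_E\circ\eta_{T(s)(E)}=\mathrm{id}_{T(s)(E)}.$$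
   Formalization: The formal theorem additionally assumes that the tensor product of two idempotent subunits is again an idempotent subunit; in an arbitrary monoidal category this can fail, and then the grading category E has no such tensor product. *)

theory Defs
  imports "HOL-Library.FuncSet"
begin

section \<open>Categories, functors and functor categories\<close>

record ('o, 'a) cat =
  Obj :: "'o set"
  Arr :: "'a set"
  Dom :: "'a \<Rightarrow> 'o"
  Cod :: "'a \<Rightarrow> 'o"
  ident :: "'o \<Rightarrow> 'a" ("id\<index>")
  comp_arr :: "'a \<Rightarrow> 'a \<Rightarrow> 'a" (infixr "\<cdot>\<index>" 65)

definition hom :: "('o, 'a, 'm) cat_scheme \<Rightarrow> 'o \<Rightarrow> 'o \<Rightarrow> 'a set" where
  "hom C a b = {f \<in> Arr C. Dom C f = a \<and> Cod C f = b}"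

locale category =
  fixes C :: "('o, 'a, 'm) cat_scheme" (structure)
  assumes Dom_Obj: "f \<in> Arr C \<Longrightarrow> Dom C f \<in> Obj C"
    and Cod_Obj: "f \<in> Arr C \<Longrightarrow> Cod C f \<in> Obj C"
    and id_hom: "a \<in> Obj C \<Longrightarrow> id a \<in> hom C a a"
    and comp_hom: "f \<in> hom C a b \<Longrightarrow> g \<in> hom C b c \<Longrightarrow> g \<cdot> f \<in> hom C a c"
    and comp_id_left: "f \<in> hom C a b \<Longrightarrow> id b \<cdot> f = f"
    and comp_id_right: "f \<in> hom C a b \<Longrightarrow> f \<cdot> id a = f"
    and comp_assoc: "f \<in> hom C a b \<Longrightarrow> g \<in> hom C b c \<Longrightarrow> h \<in> hom C c d
      \<Longrightarrow> (h \<cdot> g) \<cdot> f = h \<cdot> (g \<cdot> f)"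

definition inverse_arrows :: "('o, 'a, 'm) cat_scheme \<Rightarrow> 'a \<Rightarrow> 'a \<Rightarrow> bool" where
  "inverse_arrows C f g \<longleftrightarrow> f \<in> Arr C \<and> g \<in> hom C (Cod C f) (Dom C f) \<and>
     g \<cdot>\<^bsub>C\<^esub> f = id\<^bsub>C\<^esub> (Dom C f) \<and> f \<cdot>\<^bsub>C\<^esub> g = id\<^bsub>C\<^esub> (Cod C f)"

definition is_iso :: "('o, 'a, 'm) cat_scheme \<Rightarrow> 'a \<Rightarrow> bool" where
  "is_iso C f \<longleftrightarrow> (\<exists>g. inverse_arrows C f g)"

definition is_mono :: "('o, 'a, 'm) cat_scheme \<Rightarrow> 'a \<Rightarrow> bool" where
  "is_mono C f \<longleftrightarrow> f \<in> Arr C \<and>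
     (\<forall>a. \<forall>g \<in> hom C a (Dom C f). \<forall>h \<in> hom C a (Dom C f). f \<cdot>\<^bsub>C\<^esub> g = f \<cdot>\<^bsub>C\<^esub> h \<longrightarrow> g = h)"

record ('o, 'a, 'p, 'b) functr =
  map_obj :: "'o \<Rightarrow> 'p"
  map_arr :: "'a \<Rightarrow> 'b"

locale cat_functor = A: category A + B: category B
  for A :: "('o, 'a, 'm) cat_scheme" and B :: "('p, 'b, 'n) cat_scheme" +
  fixes F :: "('o, 'a, 'p, 'b) functr"
  assumes map_obj: "a \<in> Obj A \<Longrightarrow> map_obj F a \<in> Obj B"
    and map_arr: "f \<in> hom A a b \<Longrightarrow> map_arr F f \<in> hom B (map_obj F a) (map_obj F b)"
    and map_id: "a \<in> Obj A \<Longrightarrow> map_arr F (id\<^bsub>A\<^esub> a) = id\<^bsub>B\<^esub> (map_obj F a)"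
    and map_comp: "f \<in> hom A a b \<Longrightarrow> g \<in> hom A b c
      \<Longrightarrow> map_arr F (g \<cdot>\<^bsub>A\<^esub> f) = map_arr F g \<cdot>\<^bsub>B\<^esub> map_arr F f"

record ('o, 'a, 'p, 'b) ntrans =
  source :: "('o, 'a, 'p, 'b) functr"
  target :: "('o, 'a, 'p, 'b) functr"
  component :: "'o \<Rightarrow> 'b"

text \<open>
  Objects and arrows of a functor category are required to be \<^const>\<open>undefined\<close> outside the
  source category, so that equality in HOL is equality of functors and of natural transformations.
\<close>

definition functor_category ::
  "('o, 'a, 'm) cat_scheme \<Rightarrow> ('p, 'b, 'n) cat_scheme
    \<Rightarrow> (('o, 'a, 'p, 'b) functr, ('o, 'a, 'p, 'b) ntrans) cat" where
  "functor_category A B =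
    (let functors = {F. cat_functor A B F \<and>
           map_obj F \<in> extensional (Obj A) \<and> map_arr F \<in> extensional (Arr A)}
     in \<lparr>Obj = functors,
         Arr = {\<sigma>. source \<sigma> \<in> functors \<and> target \<sigma> \<in> functors \<and>
           component \<sigma> \<in> extensional (Obj A) \<and>
           (\<forall>a \<in> Obj A. component \<sigma> a \<in> hom B (map_obj (source \<sigma>) a) (map_obj (target \<sigma>) a)) \<and>
           (\<forall>a b. \<forall>f \<in> hom A a b.
             component \<sigma> b \<cdot>\<^bsub>B\<^esub> map_arr (source \<sigma>) f = map_arr (target \<sigma>) f \<cdot>\<^bsub>B\<^esub> component \<sigma> a)},
         Dom = source,
         Cod = target,
         ident = (\<lambda>F. \<lparr>source = F, target = F, component = (\<lambda>a\<in>Obj A. id\<^bsub>B\<^esub> (map_obj F a))\<rparr>),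
         comp_arr = (\<lambda>\<tau> \<sigma>. \<lparr>source = source \<sigma>, target = target \<tau>,
           component = (\<lambda>a\<in>Obj A. component \<tau> a \<cdot>\<^bsub>B\<^esub> component \<sigma> a)\<rparr>)\<rparr>)"

abbreviation endofunctors ::
  "('o, 'a, 'm) cat_scheme \<Rightarrow> (('o, 'a, 'o, 'a) functr, ('o, 'a, 'o, 'a) ntrans) cat" where
  "endofunctors C \<equiv> functor_category C C"

definition id_functor :: "('o, 'a, 'm) cat_scheme \<Rightarrow> ('o, 'a, 'o, 'a) functr" where
  "id_functor C = \<lparr>map_obj = (\<lambda>a\<in>Obj C. a), map_arr = (\<lambda>f\<in>Arr C. f)\<rparr>"

definition comp_functor ::
  "('o, 'a, 'm) cat_scheme \<Rightarrow> ('p, 'b, 'q, 'c) functr \<Rightarrow> ('o, 'a, 'p, 'b) functr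
    \<Rightarrow> ('o, 'a, 'q, 'c) functr" where
  "comp_functor A G F =
    \<lparr>map_obj = (\<lambda>a\<in>Obj A. map_obj G (map_obj F a)),
     map_arr = (\<lambda>f\<in>Arr A. map_arr G (map_arr F f))\<rparr>"


section \<open>Monoidal categories\<close>

record ('o, 'a) moncat = "('o, 'a) cat" +
  unit_obj :: 'o ("\<I>\<index>")
  tensor_obj :: "'o \<Rightarrow> 'o \<Rightarrow> 'o" (infixr "\<otimes>\<index>" 70)
  tensor_arr :: "'a \<Rightarrow> 'a \<Rightarrow> 'a" (infixr "\<odot>\<index>" 70)
  associator :: "'o \<Rightarrow> 'o \<Rightarrow> 'o \<Rightarrow> 'a" ("\<alpha>\<index>")
  lunitor :: "'o \<Rightarrow> 'a" ("\<l>\<index>")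
  runitor :: "'o \<Rightarrow> 'a" ("\<rho>\<index>")

locale monoidal_category = category C
  for C :: "('o, 'a, 'm) moncat_scheme" (structure) +
  assumes unit_Obj: "\<I> \<in> Obj C"
    and tensor_Obj: "a \<in> Obj C \<Longrightarrow> b \<in> Obj C \<Longrightarrow> a \<otimes> b \<in> Obj C"
    and tensor_hom: "f \<in> hom C a b \<Longrightarrow> g \<in> hom C c d \<Longrightarrow> f \<odot> g \<in> hom C (a \<otimes> c) (b \<otimes> d)"
    and tensor_id: "a \<in> Obj C \<Longrightarrow> b \<in> Obj C \<Longrightarrow> id a \<odot> id b = id (a \<otimes> b)"
    and interchange: "f \<in> hom C a b \<Longrightarrow> f' \<in> hom C b c \<Longrightarrow> g \<in> hom C d e \<Longrightarrow> g' \<in> hom C e k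
      \<Longrightarrow> (f' \<cdot> f) \<odot> (g' \<cdot> g) = (f' \<odot> g') \<cdot> (f \<odot> g)"
    and associator_hom: "a \<in> Obj C \<Longrightarrow> b \<in> Obj C \<Longrightarrow> c \<in> Obj C
      \<Longrightarrow> \<alpha> a b c \<in> hom C ((a \<otimes> b) \<otimes> c) (a \<otimes> (b \<otimes> c))"
    and associator_iso: "a \<in> Obj C \<Longrightarrow> b \<in> Obj C \<Longrightarrow> c \<in> Obj C \<Longrightarrow> is_iso C (\<alpha> a b c)"
    and associator_natural: "f \<in> hom C a a' \<Longrightarrow> g \<in> hom C b b' \<Longrightarrow> h \<in> hom C c c'
      \<Longrightarrow> \<alpha> a' b' c' \<cdot> ((f \<odot> g) \<odot> h) = (f \<odot> (g \<odot> h)) \<cdot> \<alpha> a b c"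
    and lunitor_hom: "a \<in> Obj C \<Longrightarrow> \<l> a \<in> hom C (\<I> \<otimes> a) a"
    and lunitor_iso: "a \<in> Obj C \<Longrightarrow> is_iso C (\<l> a)"
    and lunitor_natural: "f \<in> hom C a b \<Longrightarrow> \<l> b \<cdot> (id \<I> \<odot> f) = f \<cdot> \<l> a"
    and runitor_hom: "a \<in> Obj C \<Longrightarrow> \<rho> a \<in> hom C (a \<otimes> \<I>) a"
    and runitor_iso: "a \<in> Obj C \<Longrightarrow> is_iso C (\<rho> a)"
    and runitor_natural: "f \<in> hom C a b \<Longrightarrow> \<rho> b \<cdot> (f \<odot> id \<I>) = f \<cdot> \<rho> a"
    and triangle: "a \<in> Obj C \<Longrightarrow> b \<in> Obj C
      \<Longrightarrow> (id a \<odot> \<l> b) \<cdot> \<alpha> a \<I> b = \<rho> a \<odot> id b"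
    and pentagon: "a \<in> Obj C \<Longrightarrow> b \<in> Obj C \<Longrightarrow> c \<in> Obj C \<Longrightarrow> d \<in> Obj C
      \<Longrightarrow> (id a \<odot> \<alpha> b c d) \<cdot> \<alpha> a (b \<otimes> c) d \<cdot> (\<alpha> a b c \<odot> id d)
          = \<alpha> a b (c \<otimes> d) \<cdot> \<alpha> (a \<otimes> b) c d"


section \<open>Graded monads\<close>

text \<open>
  The locale spells out what it means for \<open>(T, \<eta>, \<mu>)\<close> to be a (lax) monoidal functor from \<open>E\<close> to
  the endofunctors of \<open>C\<close>, where the tensor product of endofunctors is \<open>F \<otimes> G = G \<circ> F\<close> and all
  coherence isomorphisms are identities.  In particular \<open>\<mu>\<close> is also natural in its two indices.
\<close>

locale graded_monad = E: monoidal_category E + C: category C + T: cat_functor E "endofunctors C" T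
  for E :: "('e, 'f, 'm) moncat_scheme"
    and C :: "('o, 'a, 'n) cat_scheme"
    and T :: "('e, 'f, ('o, 'a, 'o, 'a) functr, ('o, 'a, 'o, 'a) ntrans) functr" +
  fixes \<eta> :: "('o, 'a, 'o, 'a) ntrans"
    and \<mu> :: "'e \<Rightarrow> 'e \<Rightarrow> ('o, 'a, 'o, 'a) ntrans"
  assumes unit: "\<eta> \<in> hom (endofunctors C) (id_functor C) (map_obj T \<I>\<^bsub>E\<^esub>)"
    and mult: "s \<in> Obj E \<Longrightarrow> t \<in> Obj E \<Longrightarrow>
      \<mu> s t \<in> hom (endofunctors C)
        (comp_functor C (map_obj T t) (map_obj T s)) (map_obj T (s \<otimes>\<^bsub>E\<^esub> t))"
    and mult_natural: "f \<in> hom E s s' \<Longrightarrow> g \<in> hom E t t' \<Longrightarrow> X \<in> Obj C \<Longrightarrow>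
      component (map_arr T (f \<odot>\<^bsub>E\<^esub> g)) X \<cdot>\<^bsub>C\<^esub> component (\<mu> s t) X =
      component (\<mu> s' t') X \<cdot>\<^bsub>C\<^esub>
        component (map_arr T g) (map_obj (map_obj T s') X) \<cdot>\<^bsub>C\<^esub>
        map_arr (map_obj T t) (component (map_arr T f) X)"
    and mult_assoc: "r \<in> Obj E \<Longrightarrow> s \<in> Obj E \<Longrightarrow> t \<in> Obj E \<Longrightarrow> X \<in> Obj C \<Longrightarrow>
      component (map_arr T (\<alpha>\<^bsub>E\<^esub> r s t)) X \<cdot>\<^bsub>C\<^esub> component (\<mu> (r \<otimes>\<^bsub>E\<^esub> s) t) X \<cdot>\<^bsub>C\<^esub>
        map_arr (map_obj T t) (component (\<mu> r s) X) =
      component (\<mu> r (s \<otimes>\<^bsub>E\<^esub> t)) X \<cdot>\<^bsub>C\<^esub> component (\<mu> s t) (map_obj (map_obj T r) X)"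
    and mult_unit_left: "s \<in> Obj E \<Longrightarrow> X \<in> Obj C \<Longrightarrow>
      component (map_arr T (\<l>\<^bsub>E\<^esub> s)) X \<cdot>\<^bsub>C\<^esub> component (\<mu> \<I>\<^bsub>E\<^esub> s) X \<cdot>\<^bsub>C\<^esub>
        map_arr (map_obj T s) (component \<eta> X) = id\<^bsub>C\<^esub> (map_obj (map_obj T s) X)"
    and mult_unit_right: "s \<in> Obj E \<Longrightarrow> X \<in> Obj C \<Longrightarrow>
      component (map_arr T (\<rho>\<^bsub>E\<^esub> s)) X \<cdot>\<^bsub>C\<^esub> component (\<mu> s \<I>\<^bsub>E\<^esub>) X \<cdot>\<^bsub>C\<^esub>
        component \<eta> (map_obj (map_obj T s) X) = id\<^bsub>C\<^esub> (map_obj (map_obj T s) X)"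


section \<open>Idempotent subunits and restriction\<close>

definition idempotent_subunit :: "('o, 'a) moncat \<Rightarrow> 'a \<Rightarrow> bool" where
  "idempotent_subunit C s \<longleftrightarrow>
     is_mono C s \<and> Cod C s = \<I>\<^bsub>C\<^esub> \<and> is_iso C (s \<odot>\<^bsub>C\<^esub> id\<^bsub>C\<^esub> (Dom C s))"

definition tensor_subunit :: "('o, 'a) moncat \<Rightarrow> 'a \<Rightarrow> 'a \<Rightarrow> 'a" where
  "tensor_subunit C s t = \<l>\<^bsub>C\<^esub> \<I>\<^bsub>C\<^esub> \<cdot>\<^bsub>C\<^esub> (s \<odot>\<^bsub>C\<^esub> t)"

text \<open>
  The triple \<open>(s, f, t)\<close> is the arrow \<open>f\<close> of \<open>C\<close> regarded as an arrow from \<open>s\<close> to \<open>t\<close>.  In an arbitrary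
  monoidal category idempotent subunits need not be closed under \<^const>\<open>tensor_subunit\<close>:  take a
  partially ordered monoid with greatest element \<open>1\<close> and idempotents \<open>s\<close>, \<open>t\<close> whose product \<open>st\<close> is not
  idempotent.  Closure has to be assumed for the structure below to be a monoidal category.
\<close>

definition idempotent_subunits :: "('o, 'a) moncat \<Rightarrow> ('a, 'a \<times> 'a \<times> 'a) moncat" where
  "idempotent_subunits C =
    \<lparr>Obj = {s. idempotent_subunit C s},
     Arr = {(s, f, t). idempotent_subunit C s \<and> idempotent_subunit C t \<and>
       f \<in> hom C (Dom C s) (Dom C t) \<and> s = t \<cdot>\<^bsub>C\<^esub> f},
     Dom = (\<lambda>(s, f, t). s),
     Cod = (\<lambda>(s, f, t). t),
     ident = (\<lambda>s. (s, id\<^bsub>C\<^esub> (Dom C s), s)),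
     comp_arr = (\<lambda>(t, g, u) (s, f, t'). (s, g \<cdot>\<^bsub>C\<^esub> f, u)),
     unit_obj = id\<^bsub>C\<^esub> \<I>\<^bsub>C\<^esub>,
     tensor_obj = tensor_subunit C,
     tensor_arr = (\<lambda>(s, f, t) (s', f', t').
       (tensor_subunit C s s', f \<odot>\<^bsub>C\<^esub> f', tensor_subunit C t t')),
     associator = (\<lambda>r s t. (tensor_subunit C (tensor_subunit C r s) t,
       \<alpha>\<^bsub>C\<^esub> (Dom C r) (Dom C s) (Dom C t), tensor_subunit C r (tensor_subunit C s t))),
     lunitor = (\<lambda>s. (tensor_subunit C (id\<^bsub>C\<^esub> \<I>\<^bsub>C\<^esub>) s, \<l>\<^bsub>C\<^esub> (Dom C s), s)),
     runitor = (\<lambda>s. (tensor_subunit C s (id\<^bsub>C\<^esub> \<I>\<^bsub>C\<^esub>), \<rho>\<^bsub>C\<^esub> (Dom C s), s))\<rparr>"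

definition tensor_right :: "('o, 'a) moncat \<Rightarrow> 'o \<Rightarrow> ('o, 'a, 'o, 'a) functr" where
  "tensor_right C S =
    \<lparr>map_obj = (\<lambda>X\<in>Obj C. X \<otimes>\<^bsub>C\<^esub> S), map_arr = (\<lambda>h\<in>Arr C. h \<odot>\<^bsub>C\<^esub> id\<^bsub>C\<^esub> S)\<rparr>"

definition restriction ::
  "('o, 'a) moncat
    \<Rightarrow> ('a, 'a \<times> 'a \<times> 'a, ('o, 'a, 'o, 'a) functr, ('o, 'a, 'o, 'a) ntrans) functr" where
  "restriction C =
    \<lparr>map_obj = (\<lambda>s. tensor_right C (Dom C s)),
     map_arr = (\<lambda>(s, f, t). \<lparr>source = tensor_right C (Dom C s), target = tensor_right C (Dom C t),
       component = (\<lambda>X\<in>Obj C. id\<^bsub>C\<^esub> X \<odot>\<^bsub>C\<^esub> f)\<rparr>)\<rparr>"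

end

theory Submission
  imports Defs
begin

text \<open>
  Tensoring on the right turns a monoidal category \<open>C\<close> into endofunctors of itself:  \<open>S\<close> is sent to
  \<open>(-) \<otimes> S\<close>, and composing \<open>(-) \<otimes> S\<close> with \<open>(-) \<otimes> T\<close> gives \<open>((-) \<otimes> S) \<otimes> T\<close>, which the associator
  compares with \<open>(-) \<otimes> (S \<otimes> T)\<close>.  So the multiplication of the graded monad is
  \<open>\<mu> s t = \<alpha> (-) S T\<close> and its unit is the inverse of the right unitor.  Its laws are then coherence
  conditions of \<open>C\<close>:  associativity is the pentagon, the left unit law is the triangle, and the right
  unit law is the identity \<open>(id a \<odot> \<rho> b) \<cdot> \<alpha> a b \<I> = \<rho> (a \<otimes> b)\<close>, which Kelly derived from the
  pentagon and the triangle (lemma \<open>runitor_tensor\<close>).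

  The grading must also be a monoidal category.  Arrows of subunits are arrows of \<open>C\<close> over \<open>\<I>\<close>, and all
  equations between them are inherited from \<open>C\<close>;  what has to be checked is that the structure maps
  of \<open>C\<close> commute with the maps to \<open>\<I>\<close>.  For the associator and the right unitor this rests on
  \<open>\<l> \<I> = \<rho> \<I>\<close> (lemma \<open>unitors_coincide\<close>), again due to Kelly.
\<close>

section \<open>Isomorphisms\<close>

context category
begin

lemma hom_Dom: "f \<in> hom C a b \<Longrightarrow> Dom C f = a"
  and hom_Cod: "f \<in> hom C a b \<Longrightarrow> Cod C f = b"
  and hom_Arr: "f \<in> hom C a b \<Longrightarrow> f \<in> Arr C"
  by (simp_all add: hom_def)

lemma hom_Dom_Obj: "f \<in> hom C a b \<Longrightarrow> a \<in> Obj C"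
  and hom_Cod_Obj: "f \<in> hom C a b \<Longrightarrow> b \<in> Obj C"
  using Dom_Obj Cod_Obj by (auto simp: hom_def)

lemma inverse_arrows_iff:
  assumes "f \<in> hom C a b"
  shows "inverse_arrows C f g \<longleftrightarrow> g \<in> hom C b a \<and> g \<cdot> f = id a \<and> f \<cdot> g = id b"
  using assms by (auto simp: inverse_arrows_def hom_def)

lemma iso_obtain_inverse:
  assumes "is_iso C f" "f \<in> hom C a b"
  obtains g where "g \<in> hom C b a" "g \<cdot> f = id a" "f \<cdot> g = id b"
  using assms inverse_arrows_iff unfolding is_iso_def by blast

lemma is_isoI:
  "f \<in> hom C a b \<Longrightarrow> g \<in> hom C b a \<Longrightarrow> g \<cdot> f = id a \<Longrightarrow> f \<cdot> g = id b \<Longrightarrow> is_iso C f"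
  unfolding is_iso_def using inverse_arrows_iff by blast

lemma id_iso: "a \<in> Obj C \<Longrightarrow> is_iso C (id a)"
  by (blast intro: is_isoI id_hom comp_id_left)

lemma id_mono: "a \<in> Obj C \<Longrightarrow> is_mono C (id a)"
  using id_hom[of a] by (auto simp: is_mono_def hom_Arr hom_Dom comp_id_left)

lemma iso_cancel_left:
  assumes f: "is_iso C f" "f \<in> hom C b c" and g: "g \<in> hom C a b" and h: "h \<in> hom C a b"
    and eq: "f \<cdot> g = f \<cdot> h"
  shows "g = h"
proof -
  obtain k where k: "k \<in> hom C c b" "k \<cdot> f = id b"
    using iso_obtain_inverse[OF f] by blast
  have "g = k \<cdot> (f \<cdot> g)"
    using comp_assoc[OF g f(2) k(1)] k g by (simp add: comp_id_left)
  also have "\<dots> = h"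
    using comp_assoc[OF h f(2) k(1)] k h eq by (simp add: comp_id_left)
  finally show ?thesis .
qed

lemma iso_cancel_right:
  assumes f: "is_iso C f" "f \<in> hom C a b" and g: "g \<in> hom C b c" and h: "h \<in> hom C b c"
    and eq: "g \<cdot> f = h \<cdot> f"
  shows "g = h"
proof -
  obtain k where k: "k \<in> hom C b a" "f \<cdot> k = id b"
    using iso_obtain_inverse[OF f] by blast
  have "g = (g \<cdot> f) \<cdot> k"
    using comp_assoc[OF k(1) f(2) g] k g by (simp add: comp_id_right)
  also have "\<dots> = h"
    using comp_assoc[OF k(1) f(2) h] k h eq by (simp add: comp_id_right)
  finally show ?thesis .
qed

end


section \<open>Categories of functors\<close>

lemma Obj_functor_category:
  "F \<in> Obj (functor_category A B) \<longleftrightarrow>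
     cat_functor A B F \<and> map_obj F \<in> extensional (Obj A) \<and> map_arr F \<in> extensional (Arr A)"
  by (simp add: functor_category_def Let_def)

lemma hom_functor_category:
  "\<sigma> \<in> hom (functor_category A B) F G \<longleftrightarrow>
     source \<sigma> = F \<and> target \<sigma> = G \<and>
     F \<in> Obj (functor_category A B) \<and> G \<in> Obj (functor_category A B) \<and>
     component \<sigma> \<in> extensional (Obj A) \<and>
     (\<forall>a \<in> Obj A. component \<sigma> a \<in> hom B (map_obj F a) (map_obj G a)) \<and>
     (\<forall>a b. \<forall>f \<in> hom A a b.
       component \<sigma> b \<cdot>\<^bsub>B\<^esub> map_arr F f = map_arr G f \<cdot>\<^bsub>B\<^esub> component \<sigma> a)"
  by (auto simp: hom_def functor_category_def Let_def)

lemma ident_functor_category: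
  "id\<^bsub>functor_category A B\<^esub> F =
     \<lparr>source = F, target = F, component = (\<lambda>a\<in>Obj A. id\<^bsub>B\<^esub> (map_obj F a))\<rparr>"
  by (simp add: functor_category_def Let_def)

lemma comp_functor_category:
  "\<tau> \<cdot>\<^bsub>functor_category A B\<^esub> \<sigma> =
     \<lparr>source = source \<sigma>, target = target \<tau>,
      component = (\<lambda>a\<in>Obj A. component \<tau> a \<cdot>\<^bsub>B\<^esub> component \<sigma> a)\<rparr>"
  by (simp add: functor_category_def Let_def)

lemma category_functor_category:
  assumes "category A" "category B"
  shows "category (functor_category A B)"
proof -
  interpret A: category A by fact
  interpret B: category B by fact
  let ?F = "functor_category A B"
  show ?thesis
  proof
    fix \<sigma> assume "\<sigma> \<in> Arr ?F"
    then show "Dom ?F \<sigma> \<in> Obj ?F" "Cod ?F \<sigma> \<in> Obj ?F"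
      by (auto simp: functor_category_def Let_def)
  next
    fix F assume F: "F \<in> Obj ?F"
    then interpret F: cat_functor A B F by (simp add: Obj_functor_category)
    show "id\<^bsub>?F\<^esub> F \<in> hom ?F F F"
      using F A.hom_Dom_Obj A.hom_Cod_Obj
      by (auto simp: hom_functor_category ident_functor_category B.id_hom F.map_obj
          B.comp_id_left[OF F.map_arr] B.comp_id_right[OF F.map_arr])
  next
    fix F G H \<sigma> \<tau>
    assume \<sigma>: "\<sigma> \<in> hom ?F F G" and \<tau>: "\<tau> \<in> hom ?F G H"
    interpret F: cat_functor A B F using \<sigma> by (simp add: hom_functor_category Obj_functor_category)
    interpret G: cat_functor A B G using \<sigma> by (simp add: hom_functor_category Obj_functor_category)
    interpret H: cat_functor A B H using \<tau> by (simp add: hom_functor_category Obj_functor_category)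
    note \<sigma>' = \<sigma>[unfolded hom_functor_category] and \<tau>' = \<tau>[unfolded hom_functor_category]
    have "(component \<tau> b \<cdot>\<^bsub>B\<^esub> component \<sigma> b) \<cdot>\<^bsub>B\<^esub> map_arr F f
        = map_arr H f \<cdot>\<^bsub>B\<^esub> component \<tau> a \<cdot>\<^bsub>B\<^esub> component \<sigma> a" if f: "f \<in> hom A a b" for a b f
    proof -
      have [simp]: "a \<in> Obj A" "b \<in> Obj A"
        using f by (rule A.hom_Dom_Obj, rule A.hom_Cod_Obj)
      have "(component \<tau> b \<cdot>\<^bsub>B\<^esub> component \<sigma> b) \<cdot>\<^bsub>B\<^esub> map_arr F f
          = component \<tau> b \<cdot>\<^bsub>B\<^esub> component \<sigma> b \<cdot>\<^bsub>B\<^esub> map_arr F f"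
        using \<sigma>' \<tau>' f by (intro B.comp_assoc[OF F.map_arr[OF f]]) auto
      also have "\<dots> = component \<tau> b \<cdot>\<^bsub>B\<^esub> map_arr G f \<cdot>\<^bsub>B\<^esub> component \<sigma> a"
        using \<sigma>' f by auto
      also have "\<dots> = (component \<tau> b \<cdot>\<^bsub>B\<^esub> map_arr G f) \<cdot>\<^bsub>B\<^esub> component \<sigma> a"
        using \<sigma>' \<tau>' f by (intro B.comp_assoc[OF _ G.map_arr[OF f], symmetric]) auto
      also have "\<dots> = (map_arr H f \<cdot>\<^bsub>B\<^esub> component \<tau> a) \<cdot>\<^bsub>B\<^esub> component \<sigma> a"
        using \<tau>' f by auto
      also have "\<dots> = map_arr H f \<cdot>\<^bsub>B\<^esub> component \<tau> a \<cdot>\<^bsub>B\<^esub> component \<sigma> a"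
        using \<sigma>' \<tau>' f by (intro B.comp_assoc[OF _ _ H.map_arr[OF f]]) auto
      finally show ?thesis .
    qed
    then show "\<tau> \<cdot>\<^bsub>?F\<^esub> \<sigma> \<in> hom ?F F H"
      using \<sigma>' \<tau>' A.hom_Dom_Obj A.hom_Cod_Obj
      by (auto simp: hom_functor_category comp_functor_category intro: B.comp_hom)
  next
    fix F G \<sigma> assume \<sigma>: "\<sigma> \<in> hom ?F F G"
    show "id\<^bsub>?F\<^esub> G \<cdot>\<^bsub>?F\<^esub> \<sigma> = \<sigma>" "\<sigma> \<cdot>\<^bsub>?F\<^esub> id\<^bsub>?F\<^esub> F = \<sigma>"
      using \<sigma> by (auto simp: hom_functor_category comp_functor_category ident_functor_category
          B.comp_id_left B.comp_id_right intro!: ntrans.equality extensionalityI[of _ "Obj A"])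
  next
    fix F G H K \<sigma> \<tau> \<upsilon>
    assume "\<sigma> \<in> hom ?F F G" "\<tau> \<in> hom ?F G H" "\<upsilon> \<in> hom ?F H K"
    then show "(\<upsilon> \<cdot>\<^bsub>?F\<^esub> \<tau>) \<cdot>\<^bsub>?F\<^esub> \<sigma> = \<upsilon> \<cdot>\<^bsub>?F\<^esub> \<tau> \<cdot>\<^bsub>?F\<^esub> \<sigma>"
      by (auto simp: hom_functor_category comp_functor_category
          intro!: restrict_ext B.comp_assoc)
  qed
qed

lemma id_functor_Obj:
  assumes "category C"
  shows "id_functor C \<in> Obj (endofunctors C)"
proof -
  interpret category C by fact
  show ?thesis
    unfolding Obj_functor_category
    by (auto simp: id_functor_def cat_functor_def cat_functor_axioms_def assms
        intro: hom_Arr hom_Dom_Obj hom_Cod_Obj id_hom comp_hom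
        dest: hom_Arr hom_Dom_Obj hom_Cod_Obj id_hom comp_hom)
qed

lemma comp_functor_Obj:
  assumes "F \<in> Obj (functor_category A B)" "G \<in> Obj (functor_category B D)"
  shows "comp_functor A G F \<in> Obj (functor_category A D)"
proof -
  interpret F: cat_functor A B F using assms by (simp add: Obj_functor_category)
  interpret G: cat_functor B D G using assms by (simp add: Obj_functor_category)
  have "cat_functor A D (comp_functor A G F)"
  proof
    fix a assume a: "a \<in> Obj A"
    then show "map_obj (comp_functor A G F) a \<in> Obj D"
      by (simp add: comp_functor_def F.map_obj G.map_obj)
    show "map_arr (comp_functor A G F) (id\<^bsub>A\<^esub> a) = id\<^bsub>D\<^esub> (map_obj (comp_functor A G F) a)"
      using a F.A.hom_Arr[OF F.A.id_hom[OF a]]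
      by (simp add: comp_functor_def F.map_obj F.map_id G.map_id)
  next
    fix f a b assume f: "f \<in> hom A a b"
    then show "map_arr (comp_functor A G F) f
        \<in> hom D (map_obj (comp_functor A G F) a) (map_obj (comp_functor A G F) b)"
      by (simp add: comp_functor_def F.A.hom_Arr F.A.hom_Dom_Obj F.A.hom_Cod_Obj
          F.map_arr G.map_arr)
    fix g c assume g: "g \<in> hom A b c"
    show "map_arr (comp_functor A G F) (g \<cdot>\<^bsub>A\<^esub> f)
        = map_arr (comp_functor A G F) g \<cdot>\<^bsub>D\<^esub> map_arr (comp_functor A G F) f"
      using f g F.A.hom_Arr[OF F.A.comp_hom[OF f g]]
      by (simp add: comp_functor_def F.A.hom_Arr F.map_comp[OF f g]
          G.map_comp[OF F.map_arr[OF f] F.map_arr[OF g]])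
  qed
  then show ?thesis
    by (simp add: Obj_functor_category comp_functor_def)
qed


section \<open>Kelly's coherence lemmas for the unit\<close>

context monoidal_category
begin

lemmas hom_intros = comp_hom tensor_hom associator_hom lunitor_hom runitor_hom id_hom
  unit_Obj tensor_Obj

lemma tensor_unit_right_faithful:
  assumes "f \<in> hom C a b" "g \<in> hom C a b" "f \<odot> id \<I> = g \<odot> id \<I>"
  shows "f = g"
  using assms hom_Dom_Obj[OF assms(1)]
  by (metis iso_cancel_right runitor_hom runitor_iso runitor_natural)

lemma tensor_unit_left_faithful:
  assumes "f \<in> hom C a b" "g \<in> hom C a b" "id \<I> \<odot> f = id \<I> \<odot> g"
  shows "f = g"
  using assms hom_Dom_Obj[OF assms(1)]
  by (metis iso_cancel_right lunitor_hom lunitor_iso lunitor_natural)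

text \<open>
  Since \<open>(-) \<otimes> \<I>\<close> is faithful, it suffices to compare the two sides after tensoring with \<open>id \<I>\<close>.
  Then both appear, up to the isomorphism \<open>\<alpha> a b \<I>\<close>, when the pentagon for \<open>a, b, \<I>, \<I>\<close> is composed
  with \<open>id a \<odot> (id b \<odot> \<l> \<I>)\<close>:  the triangle turns the left unitor into right unitors.
\<close>

lemma runitor_tensor:
  assumes a: "a \<in> Obj C" and b: "b \<in> Obj C"
  shows "(id a \<odot> \<rho> b) \<cdot> \<alpha> a b \<I> = \<rho> (a \<otimes> b)"
proof (rule tensor_unit_right_faithful)
  let ?x = "id a \<odot> (id b \<odot> \<l> \<I>)"
  let ?p = "(id a \<odot> \<rho> b) \<cdot> \<alpha> a b \<I>"
  have x: "?x \<in> hom C (a \<otimes> (b \<otimes> (\<I> \<otimes> \<I>))) (a \<otimes> (b \<otimes> \<I>))"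
    by (rule hom_intros a b)+
  show p: "?p \<in> hom C ((a \<otimes> b) \<otimes> \<I>) (a \<otimes> b)"
    by (rule hom_intros a b)+
  show r: "\<rho> (a \<otimes> b) \<in> hom C ((a \<otimes> b) \<otimes> \<I>) (a \<otimes> b)"
    by (rule hom_intros a b)+
  have \<alpha>1: "id a \<odot> \<alpha> b \<I> \<I> \<in> hom C (a \<otimes> ((b \<otimes> \<I>) \<otimes> \<I>)) (a \<otimes> (b \<otimes> (\<I> \<otimes> \<I>)))"
    by (rule hom_intros a b)+
  have \<alpha>2: "\<alpha> a (b \<otimes> \<I>) \<I> \<in> hom C ((a \<otimes> (b \<otimes> \<I>)) \<otimes> \<I>) (a \<otimes> ((b \<otimes> \<I>) \<otimes> \<I>))"
    by (rule hom_intros a b)+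
  have \<alpha>3: "\<alpha> a b \<I> \<odot> id \<I> \<in> hom C (((a \<otimes> b) \<otimes> \<I>) \<otimes> \<I>) ((a \<otimes> (b \<otimes> \<I>)) \<otimes> \<I>)"
    by (rule hom_intros a b)+
  have \<alpha>4: "\<alpha> a b (\<I> \<otimes> \<I>) \<in> hom C ((a \<otimes> b) \<otimes> (\<I> \<otimes> \<I>)) (a \<otimes> (b \<otimes> (\<I> \<otimes> \<I>)))"
    by (rule hom_intros a b)+
  have \<alpha>5: "\<alpha> (a \<otimes> b) \<I> \<I> \<in> hom C (((a \<otimes> b) \<otimes> \<I>) \<otimes> \<I>) ((a \<otimes> b) \<otimes> (\<I> \<otimes> \<I>))"
    by (rule hom_intros a b)+
  have \<alpha>: "\<alpha> a b \<I> \<in> hom C ((a \<otimes> b) \<otimes> \<I>) (a \<otimes> (b \<otimes> \<I>))"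
    by (rule hom_intros a b)+
  have r1: "(id a \<odot> \<rho> b) \<odot> id \<I> \<in> hom C ((a \<otimes> (b \<otimes> \<I>)) \<otimes> \<I>) ((a \<otimes> b) \<otimes> \<I>)"
    by (rule hom_intros a b)+
  have l1: "id (a \<otimes> b) \<odot> \<l> \<I> \<in> hom C ((a \<otimes> b) \<otimes> (\<I> \<otimes> \<I>)) ((a \<otimes> b) \<otimes> \<I>)"
    by (rule hom_intros a b)+
  have "?x \<cdot> (id a \<odot> \<alpha> b \<I> \<I>) = (id a \<cdot> id a) \<odot> ((id b \<odot> \<l> \<I>) \<cdot> \<alpha> b \<I> \<I>)"
    by (rule interchange[symmetric]) (rule hom_intros a b)+
  also have "\<dots> = id a \<odot> (\<rho> b \<odot> id \<I>)"
    using a b by (simp add: triangle unit_Obj comp_id_left[OF id_hom])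
  finally have x_\<alpha>1: "?x \<cdot> (id a \<odot> \<alpha> b \<I> \<I>) = id a \<odot> (\<rho> b \<odot> id \<I>)" .
  have "?x \<cdot> (id a \<odot> \<alpha> b \<I> \<I>) \<cdot> \<alpha> a (b \<otimes> \<I>) \<I> \<cdot> (\<alpha> a b \<I> \<odot> id \<I>)
      = ((id a \<odot> (\<rho> b \<odot> id \<I>)) \<cdot> \<alpha> a (b \<otimes> \<I>) \<I>) \<cdot> (\<alpha> a b \<I> \<odot> id \<I>)"
    using comp_assoc[OF comp_hom[OF \<alpha>3 \<alpha>2] \<alpha>1 x]
      comp_assoc[OF \<alpha>3 \<alpha>2 comp_hom[OF \<alpha>1 x]] x_\<alpha>1 by simp
  also have "\<dots> = (\<alpha> a b \<I> \<cdot> ((id a \<odot> \<rho> b) \<odot> id \<I>)) \<cdot> (\<alpha> a b \<I> \<odot> id \<I>)"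
    using associator_natural[OF id_hom[OF a] runitor_hom[OF b] id_hom[OF unit_Obj]] by simp
  also have "\<dots> = \<alpha> a b \<I> \<cdot> ((id a \<odot> \<rho> b) \<odot> id \<I>) \<cdot> (\<alpha> a b \<I> \<odot> id \<I>)"
    by (rule comp_assoc[OF \<alpha>3 r1 \<alpha>])
  also have "((id a \<odot> \<rho> b) \<odot> id \<I>) \<cdot> (\<alpha> a b \<I> \<odot> id \<I>) = ?p \<odot> (id \<I> \<cdot> id \<I>)"
    by (rule interchange[symmetric]) (rule hom_intros a b)+
  also have "id \<I> \<cdot> id \<I> = id \<I>"
    by (rule comp_id_left[OF id_hom[OF unit_Obj]])
  finally have left: "?x \<cdot> (id a \<odot> \<alpha> b \<I> \<I>) \<cdot> \<alpha> a (b \<otimes> \<I>) \<I> \<cdot> (\<alpha> a b \<I> \<odot> id \<I>)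
      = \<alpha> a b \<I> \<cdot> (?p \<odot> id \<I>)" .
  have "?x \<cdot> \<alpha> a b (\<I> \<otimes> \<I>) \<cdot> \<alpha> (a \<otimes> b) \<I> \<I> = (?x \<cdot> \<alpha> a b (\<I> \<otimes> \<I>)) \<cdot> \<alpha> (a \<otimes> b) \<I> \<I>"
    by (rule comp_assoc[OF \<alpha>5 \<alpha>4 x, symmetric])
  also have "\<dots> = (\<alpha> a b \<I> \<cdot> (id (a \<otimes> b) \<odot> \<l> \<I>)) \<cdot> \<alpha> (a \<otimes> b) \<I> \<I>"
    using associator_natural[OF id_hom[OF a] id_hom[OF b] lunitor_hom[OF unit_Obj]]
    by (simp add: tensor_id a b)
  also have "\<dots> = \<alpha> a b \<I> \<cdot> (id (a \<otimes> b) \<odot> \<l> \<I>) \<cdot> \<alpha> (a \<otimes> b) \<I> \<I>"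
    by (rule comp_assoc[OF \<alpha>5 l1 \<alpha>])
  also have "\<dots> = \<alpha> a b \<I> \<cdot> (\<rho> (a \<otimes> b) \<odot> id \<I>)"
    by (simp add: triangle a b unit_Obj tensor_Obj)
  finally have right: "?x \<cdot> \<alpha> a b (\<I> \<otimes> \<I>) \<cdot> \<alpha> (a \<otimes> b) \<I> \<I> = \<alpha> a b \<I> \<cdot> (\<rho> (a \<otimes> b) \<odot> id \<I>)" .
  show "?p \<odot> id \<I> = \<rho> (a \<otimes> b) \<odot> id \<I>"
  proof (rule iso_cancel_left[OF associator_iso \<alpha>])
    show "\<alpha> a b \<I> \<cdot> (?p \<odot> id \<I>) = \<alpha> a b \<I> \<cdot> (\<rho> (a \<otimes> b) \<odot> id \<I>)"
      using left right pentagon[OF a b unit_Obj unit_Obj] by simp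
    show "?p \<odot> id \<I> \<in> hom C (((a \<otimes> b) \<otimes> \<I>) \<otimes> \<I>) ((a \<otimes> b) \<otimes> \<I>)"
      by (rule tensor_hom[OF p id_hom[OF unit_Obj]])
    show "\<rho> (a \<otimes> b) \<odot> id \<I> \<in> hom C (((a \<otimes> b) \<otimes> \<I>) \<otimes> \<I>) ((a \<otimes> b) \<otimes> \<I>)"
      by (rule tensor_hom[OF r id_hom[OF unit_Obj]])
  qed (fact a b unit_Obj)+
qed

text \<open>
  Naturality of \<open>\<rho>\<close> at \<open>\<rho> \<I>\<close> identifies \<open>\<rho> \<I> \<odot> id \<I>\<close> with \<open>\<rho> (\<I> \<otimes> \<I>)\<close>.  The triangle writes the former
  as \<open>(id \<I> \<odot> \<l> \<I>) \<cdot> \<alpha> \<I> \<I> \<I>\<close>, the previous lemma writes the latter as \<open>(id \<I> \<odot> \<rho> \<I>) \<cdot> \<alpha> \<I> \<I> \<I>\<close>, and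
  \<open>\<I> \<otimes> (-)\<close> is faithful.
\<close>

lemma unitors_coincide: "\<l> \<I> = \<rho> \<I>"
proof (rule tensor_unit_left_faithful)
  show l: "\<l> \<I> \<in> hom C (\<I> \<otimes> \<I>) \<I>" and r: "\<rho> \<I> \<in> hom C (\<I> \<otimes> \<I>) \<I>"
    by (rule hom_intros)+
  have "\<rho> \<I> \<odot> id \<I> = \<rho> (\<I> \<otimes> \<I>)"
  proof (rule iso_cancel_left[OF runitor_iso r])
    show "\<rho> \<I> \<cdot> (\<rho> \<I> \<odot> id \<I>) = \<rho> \<I> \<cdot> \<rho> (\<I> \<otimes> \<I>)"
      by (rule runitor_natural[OF r])
  qed (rule hom_intros)+
  then have eq: "(id \<I> \<odot> \<l> \<I>) \<cdot> \<alpha> \<I> \<I> \<I> = (id \<I> \<odot> \<rho> \<I>) \<cdot> \<alpha> \<I> \<I> \<I>"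
    by (simp add: triangle runitor_tensor unit_Obj)
  show "id \<I> \<odot> \<l> \<I> = id \<I> \<odot> \<rho> \<I>"
    by (rule iso_cancel_right[OF associator_iso associator_hom _ _ eq]) (rule hom_intros)+
qed

end


section \<open>The monoidal category of idempotent subunits\<close>

locale tensor_closed_subunits = monoidal_category C
  for C :: "('o, 'a) moncat" (structure) +
  assumes closed: "idempotent_subunit C s \<Longrightarrow> idempotent_subunit C t
    \<Longrightarrow> idempotent_subunit C (tensor_subunit C s t)"
begin

abbreviation E :: "('a, 'a \<times> 'a \<times> 'a) moncat" where
  "E \<equiv> idempotent_subunits C"

lemma subunit_hom: "idempotent_subunit C s \<Longrightarrow> s \<in> hom C (Dom C s) \<I>"
  by (simp add: idempotent_subunit_def is_mono_def hom_def)

lemma subunit_Dom_Obj: "idempotent_subunit C s \<Longrightarrow> Dom C s \<in> Obj C"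
  by (rule hom_Dom_Obj[OF subunit_hom])

lemma Dom_id: "a \<in> Obj C \<Longrightarrow> Dom C (id a) = a"
  by (rule hom_Dom[OF id_hom])

lemma unit_subunit: "idempotent_subunit C (id \<I>)"
  by (simp add: idempotent_subunit_def unit_Obj id_mono id_iso tensor_Obj Dom_id tensor_id
      hom_Cod[OF id_hom])

lemma tensor_subunit_hom:
  assumes "s \<in> hom C a \<I>" "t \<in> hom C b \<I>"
  shows "tensor_subunit C s t \<in> hom C (a \<otimes> b) \<I>"
  unfolding tensor_subunit_def by (rule hom_intros assms)+

lemma Dom_tensor_subunit:
  "idempotent_subunit C s \<Longrightarrow> idempotent_subunit C t
    \<Longrightarrow> Dom C (tensor_subunit C s t) = Dom C s \<otimes> Dom C t"
  by (rule hom_Dom[OF tensor_subunit_hom[OF subunit_hom subunit_hom]])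

lemma tensor_subunit_comp:
  assumes f: "f \<in> hom C a b" and s: "s \<in> hom C b \<I>" and g: "g \<in> hom C c d" and t: "t \<in> hom C d \<I>"
  shows "tensor_subunit C (s \<cdot> f) (t \<cdot> g) = tensor_subunit C s t \<cdot> (f \<odot> g)"
  unfolding tensor_subunit_def interchange[OF f s g t]
  by (rule comp_assoc[OF tensor_hom[OF f g] tensor_hom[OF s t] lunitor_hom[OF unit_Obj], symmetric])

lemma lunitor_over_unit:
  assumes "s \<in> hom C a \<I>"
  shows "tensor_subunit C (id \<I>) s = s \<cdot> \<l> a"
  unfolding tensor_subunit_def by (rule lunitor_natural[OF assms])

lemma runitor_over_unit:
  assumes "s \<in> hom C a \<I>"
  shows "tensor_subunit C s (id \<I>) = s \<cdot> \<rho> a"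
  unfolding tensor_subunit_def unitors_coincide by (rule runitor_natural[OF assms])

text \<open>
  By naturality of \<open>\<alpha>\<close> the claim reduces to the associator of the three copies of \<open>\<I>\<close>, where the triangle
  leaves the difference between \<open>\<rho> \<I> \<odot> id \<I>\<close> and \<open>\<l> \<I> \<odot> id \<I>\<close>.
\<close>

lemma associator_over_unit:
  assumes r: "r \<in> hom C a \<I>" and s: "s \<in> hom C b \<I>" and t: "t \<in> hom C c \<I>"
  shows "tensor_subunit C (tensor_subunit C r s) t
    = tensor_subunit C r (tensor_subunit C s t) \<cdot> \<alpha> a b c"
proof -
  note objs = hom_Dom_Obj[OF r] hom_Dom_Obj[OF s] hom_Dom_Obj[OF t]
  have l: "\<l> \<I> \<in> hom C (\<I> \<otimes> \<I>) \<I>" and i: "id \<I> \<in> hom C \<I> \<I>"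
    by (rule hom_intros)+
  have rs: "r \<odot> s \<in> hom C (a \<otimes> b) (\<I> \<otimes> \<I>)" and st: "s \<odot> t \<in> hom C (b \<otimes> c) (\<I> \<otimes> \<I>)"
    by (rule hom_intros r s t)+
  have rs_t: "(r \<odot> s) \<odot> t \<in> hom C ((a \<otimes> b) \<otimes> c) ((\<I> \<otimes> \<I>) \<otimes> \<I>)"
    by (rule hom_intros r s t)+
  have r_st: "r \<odot> (s \<odot> t) \<in> hom C (a \<otimes> (b \<otimes> c)) (\<I> \<otimes> (\<I> \<otimes> \<I>))"
    by (rule hom_intros r s t)+
  have il: "id \<I> \<odot> \<l> \<I> \<in> hom C (\<I> \<otimes> (\<I> \<otimes> \<I>)) (\<I> \<otimes> \<I>)"
    by (rule hom_intros)+
  have \<alpha>: "\<alpha> a b c \<in> hom C ((a \<otimes> b) \<otimes> c) (a \<otimes> (b \<otimes> c))"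
    and \<alpha>\<I>: "\<alpha> \<I> \<I> \<I> \<in> hom C ((\<I> \<otimes> \<I>) \<otimes> \<I>) (\<I> \<otimes> (\<I> \<otimes> \<I>))"
    by (rule hom_intros objs)+
  have "tensor_subunit C r s \<odot> t = (\<l> \<I> \<odot> id \<I>) \<cdot> ((r \<odot> s) \<odot> t)"
    using interchange[OF rs l t i] by (simp add: tensor_subunit_def comp_id_left[OF t])
  also have "\<dots> = ((id \<I> \<odot> \<l> \<I>) \<cdot> \<alpha> \<I> \<I> \<I>) \<cdot> ((r \<odot> s) \<odot> t)"
    using triangle[OF unit_Obj unit_Obj] unitors_coincide by simp
  also have "\<dots> = (id \<I> \<odot> \<l> \<I>) \<cdot> \<alpha> \<I> \<I> \<I> \<cdot> ((r \<odot> s) \<odot> t)"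
    by (rule comp_assoc[OF rs_t \<alpha>\<I> il])
  also have "\<dots> = (id \<I> \<odot> \<l> \<I>) \<cdot> (r \<odot> (s \<odot> t)) \<cdot> \<alpha> a b c"
    by (simp add: associator_natural[OF r s t])
  also have "\<dots> = ((id \<I> \<odot> \<l> \<I>) \<cdot> (r \<odot> (s \<odot> t))) \<cdot> \<alpha> a b c"
    by (rule comp_assoc[OF \<alpha> r_st il, symmetric])
  also have "(id \<I> \<odot> \<l> \<I>) \<cdot> (r \<odot> (s \<odot> t)) = r \<odot> tensor_subunit C s t"
    using interchange[OF r i st l] by (simp add: tensor_subunit_def comp_id_left[OF r])
  finally show ?thesis
    using comp_assoc[OF \<alpha> tensor_hom[OF r tensor_subunit_hom[OF s t]] l]
    by (simp add: tensor_subunit_def)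
qed

lemma Obj_subunits: "s \<in> Obj E \<longleftrightarrow> idempotent_subunit C s"
  by (simp add: idempotent_subunits_def)

lemma hom_subunits:
  "p \<in> hom E s t \<longleftrightarrow> (\<exists>f. p = (s, f, t) \<and> idempotent_subunit C s \<and> idempotent_subunit C t \<and>
     f \<in> hom C (Dom C s) (Dom C t) \<and> s = t \<cdot> f)"
  unfolding hom_def by (auto simp: idempotent_subunits_def hom_def)

lemma subunits_homI:
  "idempotent_subunit C s \<Longrightarrow> idempotent_subunit C t \<Longrightarrow> f \<in> hom C (Dom C s) (Dom C t)
    \<Longrightarrow> s = t \<cdot> f \<Longrightarrow> (s, f, t) \<in> hom E s t"
  by (simp add: hom_subunits)

lemma subunits_simps:
  "id\<^bsub>E\<^esub> s = (s, id (Dom C s), s)"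
  "(t', g, u) \<cdot>\<^bsub>E\<^esub> (s, f, t) = (s, g \<cdot> f, u)"
  "\<I>\<^bsub>E\<^esub> = id \<I>"
  "s \<otimes>\<^bsub>E\<^esub> t = tensor_subunit C s t"
  "(s, f, t) \<odot>\<^bsub>E\<^esub> (s', f', t') = (tensor_subunit C s s', f \<odot> f', tensor_subunit C t t')"
  "\<alpha>\<^bsub>E\<^esub> r s t = (tensor_subunit C (tensor_subunit C r s) t,
     \<alpha> (Dom C r) (Dom C s) (Dom C t), tensor_subunit C r (tensor_subunit C s t))"
  "\<l>\<^bsub>E\<^esub> s = (tensor_subunit C (id \<I>) s, \<l> (Dom C s), s)"
  "\<rho>\<^bsub>E\<^esub> s = (tensor_subunit C s (id \<I>), \<rho> (Dom C s), s)"
  by (simp_all add: idempotent_subunits_def)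

lemma category_subunits: "category E"
proof
  fix p assume "p \<in> Arr E"
  then show "Dom E p \<in> Obj E" "Cod E p \<in> Obj E"
    by (auto simp: idempotent_subunits_def)
next
  fix s assume "s \<in> Obj E"
  then show "id\<^bsub>E\<^esub> s \<in> hom E s s"
    using comp_id_right[OF subunit_hom]
    by (simp add: Obj_subunits hom_subunits subunits_simps id_hom subunit_Dom_Obj)
next
  fix p q s t u assume "p \<in> hom E s t" "q \<in> hom E t u"
  then show "q \<cdot>\<^bsub>E\<^esub> p \<in> hom E s u"
    using comp_assoc[OF _ _ subunit_hom]
    by (auto simp: hom_subunits subunits_simps intro: comp_hom)
next
  fix p s t assume "p \<in> hom E s t"
  then show "id\<^bsub>E\<^esub> t \<cdot>\<^bsub>E\<^esub> p = p" "p \<cdot>\<^bsub>E\<^esub> id\<^bsub>E\<^esub> s = p"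
    by (auto simp: hom_subunits subunits_simps comp_id_left comp_id_right)
next
  fix p q r s t u v assume "p \<in> hom E s t" "q \<in> hom E t u" "r \<in> hom E u v"
  then show "(r \<cdot>\<^bsub>E\<^esub> q) \<cdot>\<^bsub>E\<^esub> p = r \<cdot>\<^bsub>E\<^esub> q \<cdot>\<^bsub>E\<^esub> p"
    by (auto simp: hom_subunits subunits_simps comp_assoc)
qed

text \<open>
  If \<open>s = t \<cdot> f\<close> and \<open>g\<close> inverts \<open>f\<close> then \<open>t = s \<cdot> g\<close>, so \<open>g\<close> is an arrow of subunits too.  This makes the
  structure maps of the subunits invertible as soon as those of \<open>C\<close> are.
\<close>

lemma subunits_iso:
  assumes p: "(s, f, t) \<in> hom E s t" and f: "is_iso C f"
  shows "is_iso E (s, f, t)"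
proof -
  interpret E: category E by (rule category_subunits)
  have s: "idempotent_subunit C s" and t: "idempotent_subunit C t"
    and f_hom: "f \<in> hom C (Dom C s) (Dom C t)" and s_eq: "s = t \<cdot> f"
    using p by (auto simp: hom_subunits)
  obtain g where g: "g \<in> hom C (Dom C t) (Dom C s)" "g \<cdot> f = id (Dom C s)" "f \<cdot> g = id (Dom C t)"
    using iso_obtain_inverse[OF f f_hom] .
  have "s \<cdot> g = t"
    using comp_assoc[OF g(1) f_hom subunit_hom[OF t]] g(3) comp_id_right[OF subunit_hom[OF t]]
    by (simp flip: s_eq)
  then have "(t, g, s) \<in> hom E t s"
    using s t g by (simp add: hom_subunits)
  then show ?thesis
    by (rule E.is_isoI[OF p]) (simp_all add: subunits_simps g)
qed

lemma tensor_subunits_hom: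
  assumes p: "p \<in> hom E s t" and q: "q \<in> hom E s' t'"
  shows "p \<odot>\<^bsub>E\<^esub> q \<in> hom E (s \<otimes>\<^bsub>E\<^esub> s') (t \<otimes>\<^bsub>E\<^esub> t')"
proof -
  obtain f where f: "p = (s, f, t)" "idempotent_subunit C s" "idempotent_subunit C t"
      "f \<in> hom C (Dom C s) (Dom C t)" "s = t \<cdot> f"
    using p by (auto simp: hom_subunits)
  obtain g where g: "q = (s', g, t')" "idempotent_subunit C s'" "idempotent_subunit C t'"
      "g \<in> hom C (Dom C s') (Dom C t')" "s' = t' \<cdot> g"
    using q by (auto simp: hom_subunits)
  have over: "tensor_subunit C s s' = tensor_subunit C t t' \<cdot> (f \<odot> g)"
    using tensor_subunit_comp[OF f(4) subunit_hom[OF f(3)] g(4) subunit_hom[OF g(3)]]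
    by (simp flip: f(5) g(5))
  show ?thesis
    unfolding f(1) g(1) subunits_simps
    by (rule subunits_homI[OF _ _ _ over])
      (simp_all add: f(2-4) g(2-4) Dom_tensor_subunit closed tensor_hom)
qed

lemma associator_subunits_hom:
  assumes "r \<in> Obj E" "s \<in> Obj E" "t \<in> Obj E"
  shows "\<alpha>\<^bsub>E\<^esub> r s t \<in> hom E ((r \<otimes>\<^bsub>E\<^esub> s) \<otimes>\<^bsub>E\<^esub> t) (r \<otimes>\<^bsub>E\<^esub> (s \<otimes>\<^bsub>E\<^esub> t))"
  using assms unfolding Obj_subunits subunits_simps
  by (intro subunits_homI[OF _ _ _ associator_over_unit[OF subunit_hom subunit_hom subunit_hom]])
    (simp_all add: closed Dom_tensor_subunit associator_hom subunit_Dom_Obj)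

lemma lunitor_subunits_hom:
  assumes "s \<in> Obj E"
  shows "\<l>\<^bsub>E\<^esub> s \<in> hom E (\<I>\<^bsub>E\<^esub> \<otimes>\<^bsub>E\<^esub> s) s"
  using assms unfolding Obj_subunits subunits_simps
  by (intro subunits_homI[OF _ _ _ lunitor_over_unit[OF subunit_hom]])
    (simp_all add: closed unit_subunit Dom_tensor_subunit Dom_id unit_Obj lunitor_hom
      subunit_Dom_Obj)

lemma runitor_subunits_hom:
  assumes "s \<in> Obj E"
  shows "\<rho>\<^bsub>E\<^esub> s \<in> hom E (s \<otimes>\<^bsub>E\<^esub> \<I>\<^bsub>E\<^esub>) s"
  using assms unfolding Obj_subunits subunits_simps
  by (intro subunits_homI[OF _ _ _ runitor_over_unit[OF subunit_hom]])
    (simp_all add: closed unit_subunit Dom_tensor_subunit Dom_id unit_Obj runitor_hom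
      subunit_Dom_Obj)

text \<open>
  Two parallel arrows of subunits are equal when their underlying arrows of \<open>C\<close> are, so every
  equation below is the same equation in \<open>C\<close>.
\<close>

lemma monoidal_category_subunits: "monoidal_category E"
proof (intro monoidal_category.intro monoidal_category_axioms.intro)
  show "category E" by (rule category_subunits)
  show "\<I>\<^bsub>E\<^esub> \<in> Obj E"
    by (simp add: subunits_simps Obj_subunits unit_subunit)
next
  fix s t assume s: "s \<in> Obj E" and t: "t \<in> Obj E"
  show "s \<otimes>\<^bsub>E\<^esub> t \<in> Obj E"
    using s t by (simp add: subunits_simps Obj_subunits closed)
  show "id\<^bsub>E\<^esub> s \<odot>\<^bsub>E\<^esub> id\<^bsub>E\<^esub> t = id\<^bsub>E\<^esub> (s \<otimes>\<^bsub>E\<^esub> t)"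
    using s t by (simp add: subunits_simps Obj_subunits Dom_tensor_subunit tensor_id
        subunit_Dom_Obj)
  show "(id\<^bsub>E\<^esub> s \<odot>\<^bsub>E\<^esub> \<l>\<^bsub>E\<^esub> t) \<cdot>\<^bsub>E\<^esub> \<alpha>\<^bsub>E\<^esub> s \<I>\<^bsub>E\<^esub> t = \<rho>\<^bsub>E\<^esub> s \<odot>\<^bsub>E\<^esub> id\<^bsub>E\<^esub> t"
    using s t by (simp add: subunits_simps Obj_subunits Dom_id unit_Obj triangle subunit_Dom_Obj)
next
  fix p q s t s' t' assume "p \<in> hom E s t" "q \<in> hom E s' t'"
  then show "p \<odot>\<^bsub>E\<^esub> q \<in> hom E (s \<otimes>\<^bsub>E\<^esub> s') (t \<otimes>\<^bsub>E\<^esub> t')"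
    by (rule tensor_subunits_hom)
next
  fix p p' q q' s t u s' t' u'
  assume "p \<in> hom E s t" "p' \<in> hom E t u" "q \<in> hom E s' t'" "q' \<in> hom E t' u'"
  then show "(p' \<cdot>\<^bsub>E\<^esub> p) \<odot>\<^bsub>E\<^esub> (q' \<cdot>\<^bsub>E\<^esub> q) = (p' \<odot>\<^bsub>E\<^esub> q') \<cdot>\<^bsub>E\<^esub> (p \<odot>\<^bsub>E\<^esub> q)"
    by (auto simp: hom_subunits subunits_simps interchange)
next
  fix r s t assume rst: "r \<in> Obj E" "s \<in> Obj E" "t \<in> Obj E"
  show \<alpha>: "\<alpha>\<^bsub>E\<^esub> r s t \<in> hom E ((r \<otimes>\<^bsub>E\<^esub> s) \<otimes>\<^bsub>E\<^esub> t) (r \<otimes>\<^bsub>E\<^esub> (s \<otimes>\<^bsub>E\<^esub> t))"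
    using rst by (rule associator_subunits_hom)
  show "is_iso E (\<alpha>\<^bsub>E\<^esub> r s t)"
    using subunits_iso[OF \<alpha>[unfolded subunits_simps]] rst
    by (simp add: subunits_simps Obj_subunits associator_iso subunit_Dom_Obj)
next
  fix p q h r r' s s' t t'
  assume "p \<in> hom E r r'" "q \<in> hom E s s'" "h \<in> hom E t t'"
  then show "\<alpha>\<^bsub>E\<^esub> r' s' t' \<cdot>\<^bsub>E\<^esub> ((p \<odot>\<^bsub>E\<^esub> q) \<odot>\<^bsub>E\<^esub> h) = (p \<odot>\<^bsub>E\<^esub> (q \<odot>\<^bsub>E\<^esub> h)) \<cdot>\<^bsub>E\<^esub> \<alpha>\<^bsub>E\<^esub> r s t"
    by (auto simp: hom_subunits subunits_simps associator_natural)
next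
  fix s assume s: "s \<in> Obj E"
  show l: "\<l>\<^bsub>E\<^esub> s \<in> hom E (\<I>\<^bsub>E\<^esub> \<otimes>\<^bsub>E\<^esub> s) s"
    using s by (rule lunitor_subunits_hom)
  show "is_iso E (\<l>\<^bsub>E\<^esub> s)"
    using subunits_iso[OF l[unfolded subunits_simps]] s
    by (simp add: subunits_simps Obj_subunits lunitor_iso subunit_Dom_Obj)
  show r: "\<rho>\<^bsub>E\<^esub> s \<in> hom E (s \<otimes>\<^bsub>E\<^esub> \<I>\<^bsub>E\<^esub>) s"
    using s by (rule runitor_subunits_hom)
  show "is_iso E (\<rho>\<^bsub>E\<^esub> s)"
    using subunits_iso[OF r[unfolded subunits_simps]] s
    by (simp add: subunits_simps Obj_subunits runitor_iso subunit_Dom_Obj)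
next
  fix p s t assume "p \<in> hom E s t"
  then show "\<l>\<^bsub>E\<^esub> t \<cdot>\<^bsub>E\<^esub> (id\<^bsub>E\<^esub> \<I>\<^bsub>E\<^esub> \<odot>\<^bsub>E\<^esub> p) = p \<cdot>\<^bsub>E\<^esub> \<l>\<^bsub>E\<^esub> s"
    and "\<rho>\<^bsub>E\<^esub> t \<cdot>\<^bsub>E\<^esub> (p \<odot>\<^bsub>E\<^esub> id\<^bsub>E\<^esub> \<I>\<^bsub>E\<^esub>) = p \<cdot>\<^bsub>E\<^esub> \<rho>\<^bsub>E\<^esub> s"
    by (auto simp: hom_subunits subunits_simps Dom_id unit_Obj lunitor_natural runitor_natural)
next
  fix r s t u assume "r \<in> Obj E" "s \<in> Obj E" "t \<in> Obj E" "u \<in> Obj E"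
  then show "(id\<^bsub>E\<^esub> r \<odot>\<^bsub>E\<^esub> \<alpha>\<^bsub>E\<^esub> s t u) \<cdot>\<^bsub>E\<^esub> \<alpha>\<^bsub>E\<^esub> r (s \<otimes>\<^bsub>E\<^esub> t) u \<cdot>\<^bsub>E\<^esub> (\<alpha>\<^bsub>E\<^esub> r s t \<odot>\<^bsub>E\<^esub> id\<^bsub>E\<^esub> u)
      = \<alpha>\<^bsub>E\<^esub> r s (t \<otimes>\<^bsub>E\<^esub> u) \<cdot>\<^bsub>E\<^esub> \<alpha>\<^bsub>E\<^esub> (r \<otimes>\<^bsub>E\<^esub> s) t u"
    by (simp add: Obj_subunits subunits_simps Dom_tensor_subunit pentagon subunit_Dom_Obj)
qed

end


section \<open>Restriction\<close>

context monoidal_category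
begin

lemma tensor_split:
  assumes f: "f \<in> hom C a b" and g: "g \<in> hom C c d"
  shows "(id b \<odot> g) \<cdot> (f \<odot> id c) = f \<odot> g" and "(f \<odot> id d) \<cdot> (id a \<odot> g) = f \<odot> g"
  using interchange[OF f id_hom[OF hom_Cod_Obj[OF f]] id_hom[OF hom_Dom_Obj[OF g]] g]
    interchange[OF id_hom[OF hom_Dom_Obj[OF f]] f g id_hom[OF hom_Cod_Obj[OF g]]]
    comp_id_left[OF f] comp_id_right[OF f] comp_id_left[OF g] comp_id_right[OF g]
  by simp_all

lemma tensor_comp_id_right:
  "f \<in> hom C a b \<Longrightarrow> g \<in> hom C b c \<Longrightarrow> d \<in> Obj C \<Longrightarrow> (g \<cdot> f) \<odot> id d = (g \<odot> id d) \<cdot> (f \<odot> id d)"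
  using interchange[of f a b g c "id d" d d "id d" d] by (simp add: id_hom comp_id_left[OF id_hom])

lemma tensor_comp_id_left:
  "f \<in> hom C a b \<Longrightarrow> g \<in> hom C b c \<Longrightarrow> d \<in> Obj C \<Longrightarrow> id d \<odot> (g \<cdot> f) = (id d \<odot> g) \<cdot> (id d \<odot> f)"
  using interchange[of "id d" d d "id d" d f a b g c] by (simp add: id_hom comp_id_left[OF id_hom])

definition runitor_inv :: "'o \<Rightarrow> 'a" where
  "runitor_inv X = (SOME g. inverse_arrows C (\<rho> X) g)"

lemma runitor_inv:
  assumes "X \<in> Obj C"
  shows "runitor_inv X \<in> hom C X (X \<otimes> \<I>)"
    and "runitor_inv X \<cdot> \<rho> X = id (X \<otimes> \<I>)" and "\<rho> X \<cdot> runitor_inv X = id X"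
proof -
  have "inverse_arrows C (\<rho> X) (runitor_inv X)"
    unfolding runitor_inv_def using runitor_iso[OF assms] by (simp add: is_iso_def someI_ex)
  then show "runitor_inv X \<in> hom C X (X \<otimes> \<I>)"
    "runitor_inv X \<cdot> \<rho> X = id (X \<otimes> \<I>)" "\<rho> X \<cdot> runitor_inv X = id X"
    by (simp_all add: inverse_arrows_iff[OF runitor_hom[OF assms]])
qed

lemma runitor_inv_natural:
  assumes f: "f \<in> hom C a b"
  shows "runitor_inv b \<cdot> f = (f \<odot> id \<I>) \<cdot> runitor_inv a"
proof (rule iso_cancel_left[OF runitor_iso runitor_hom])
  have a: "a \<in> Obj C" and b: "b \<in> Obj C"
    using f by (rule hom_Dom_Obj, rule hom_Cod_Obj)
  then show "b \<in> Obj C" "b \<in> Obj C" by blast+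
  have fi: "f \<odot> id \<I> \<in> hom C (a \<otimes> \<I>) (b \<otimes> \<I>)"
    by (rule hom_intros f)+
  show "runitor_inv b \<cdot> f \<in> hom C a (b \<otimes> \<I>)" "(f \<odot> id \<I>) \<cdot> runitor_inv a \<in> hom C a (b \<otimes> \<I>)"
    using runitor_inv(1)[OF a] runitor_inv(1)[OF b] fi f by (blast intro: comp_hom)+
  have "\<rho> b \<cdot> runitor_inv b \<cdot> f = f"
    using comp_assoc[OF f runitor_inv(1)[OF b] runitor_hom[OF b]] runitor_inv(3)[OF b]
      comp_id_left[OF f] by simp
  also have "f = f \<cdot> \<rho> a \<cdot> runitor_inv a"
    using runitor_inv(3)[OF a] comp_id_right[OF f] by simp
  also have "\<dots> = \<rho> b \<cdot> (f \<odot> id \<I>) \<cdot> runitor_inv a"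
    using comp_assoc[OF runitor_inv(1)[OF a] runitor_hom[OF a] f]
      comp_assoc[OF runitor_inv(1)[OF a] fi runitor_hom[OF b]] runitor_natural[OF f] by simp
  finally show "\<rho> b \<cdot> runitor_inv b \<cdot> f = \<rho> b \<cdot> (f \<odot> id \<I>) \<cdot> runitor_inv a" .
qed

end

context tensor_closed_subunits
begin

lemma tensor_right_simps:
  "X \<in> Obj C \<Longrightarrow> map_obj (tensor_right C S) X = X \<otimes> S"
  "h \<in> hom C X Y \<Longrightarrow> map_arr (tensor_right C S) h = h \<odot> id S"
  by (simp_all add: tensor_right_def hom_Arr)

lemma tensor_right_Obj:
  assumes S: "S \<in> Obj C"
  shows "tensor_right C S \<in> Obj (endofunctors C)"
proof -
  have "cat_functor C C (tensor_right C S)"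
  proof
    fix a assume "a \<in> Obj C"
    then show "map_obj (tensor_right C S) a \<in> Obj C"
      "map_arr (tensor_right C S) (id a) = id (map_obj (tensor_right C S) a)"
      using S by (simp_all add: tensor_right_simps tensor_right_simps(2)[OF id_hom] tensor_Obj tensor_id)
  next
    fix f a b assume f: "f \<in> hom C a b"
    then show "map_arr (tensor_right C S) f
        \<in> hom C (map_obj (tensor_right C S) a) (map_obj (tensor_right C S) b)"
      using S by (simp add: tensor_right_simps hom_Dom_Obj hom_Cod_Obj tensor_hom id_hom)
    fix g c assume g: "g \<in> hom C b c"
    show "map_arr (tensor_right C S) (g \<cdot> f)
        = map_arr (tensor_right C S) g \<cdot> map_arr (tensor_right C S) f"
      using f g S comp_hom[OF f g] by (simp add: tensor_right_simps tensor_comp_id_right)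
  qed
  then show ?thesis
    by (simp add: Obj_functor_category tensor_right_def)
qed

lemma restriction_obj: "map_obj (restriction C) s = tensor_right C (Dom C s)"
  by (simp add: restriction_def)

lemma restriction_arr:
  "map_arr (restriction C) (s, f, t) =
     \<lparr>source = tensor_right C (Dom C s), target = tensor_right C (Dom C t),
      component = (\<lambda>X\<in>Obj C. id X \<odot> f)\<rparr>"
  by (simp add: restriction_def)

text \<open>
  Functoriality in the subunit and naturality of each \<open>id \<odot> f\<close> are both instances of the interchange
  law, with identities in one of the two factors.
\<close>

lemma restriction_functor: "cat_functor E (endofunctors C) (restriction C)"
proof (intro cat_functor.intro cat_functor_axioms.intro)
  show "category E" by (rule category_subunits)
  show "category (endofunctors C)" by (intro category_functor_category category_axioms)
next
  fix s assume "s \<in> Obj E"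
  then have S: "Dom C s \<in> Obj C" by (simp add: Obj_subunits subunit_Dom_Obj)
  then show "map_obj (restriction C) s \<in> Obj (endofunctors C)"
    by (simp add: restriction_obj tensor_right_Obj)
  show "map_arr (restriction C) (id\<^bsub>E\<^esub> s) = id\<^bsub>endofunctors C\<^esub> (map_obj (restriction C) s)"
    using S by (auto simp: subunits_simps restriction_arr restriction_obj ident_functor_category
        tensor_right_simps tensor_id intro!: restrict_ext)
next
  fix p s t assume "p \<in> hom E s t"
  then obtain f where p: "p = (s, f, t)" and s: "idempotent_subunit C s"
    and t: "idempotent_subunit C t" and f: "f \<in> hom C (Dom C s) (Dom C t)"
    by (auto simp: hom_subunits)
  show "map_arr (restriction C) p
      \<in> hom (endofunctors C) (map_obj (restriction C) s) (map_obj (restriction C) t)"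
    using s t f
    by (auto simp: p hom_functor_category restriction_arr restriction_obj tensor_right_Obj
        subunit_Dom_Obj tensor_right_simps tensor_split hom_Dom_Obj hom_Cod_Obj
        intro: tensor_hom id_hom)
  fix q u assume "q \<in> hom E t u"
  then show "map_arr (restriction C) (q \<cdot>\<^bsub>E\<^esub> p)
      = map_arr (restriction C) q \<cdot>\<^bsub>endofunctors C\<^esub> map_arr (restriction C) p"
    using f
    by (auto simp: p hom_subunits subunits_simps restriction_arr comp_functor_category
        tensor_comp_id_left intro!: restrict_ext)
qed

definition restriction_unit :: "('o, 'a, 'o, 'a) ntrans" where
  "restriction_unit =
    \<lparr>source = id_functor C, target = tensor_right C \<I>, component = (\<lambda>X\<in>Obj C. runitor_inv X)\<rparr>"

definition restriction_mult :: "'a \<Rightarrow> 'a \<Rightarrow> ('o, 'a, 'o, 'a) ntrans" where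
  "restriction_mult s t =
    \<lparr>source = comp_functor C (tensor_right C (Dom C t)) (tensor_right C (Dom C s)),
     target = tensor_right C (Dom C s \<otimes> Dom C t),
     component = (\<lambda>X\<in>Obj C. \<alpha> X (Dom C s) (Dom C t))\<rparr>"

lemma restriction_unit_hom:
  "restriction_unit \<in> hom (endofunctors C) (id_functor C) (tensor_right C \<I>)"
proof -
  have "id_functor C \<in> Obj (endofunctors C)" "tensor_right C \<I> \<in> Obj (endofunctors C)"
    using id_functor_Obj[OF category_axioms] tensor_right_Obj[OF unit_Obj] .
  then show ?thesis
    by (auto simp: hom_functor_category restriction_unit_def tensor_right_simps id_functor_def
        runitor_inv runitor_inv_natural hom_Arr hom_Dom_Obj hom_Cod_Obj)
qed

text \<open>Naturality in \<open>X\<close> is naturality of \<open>\<alpha>\<close> with identities in the second and third argument.\<close>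

lemma restriction_mult_hom:
  assumes s: "idempotent_subunit C s" and t: "idempotent_subunit C t"
  shows "restriction_mult s t \<in> hom (endofunctors C)
    (comp_functor C (tensor_right C (Dom C t)) (tensor_right C (Dom C s)))
    (tensor_right C (Dom C s \<otimes> Dom C t))"
proof -
  let ?S = "Dom C s" and ?T = "Dom C t"
  have S: "?S \<in> Obj C" and T: "?T \<in> Obj C"
    using s t by (simp_all add: subunit_Dom_Obj)
  have "\<alpha> b ?S ?T \<cdot> ((f \<odot> id ?S) \<odot> id ?T) = (f \<odot> id (?S \<otimes> ?T)) \<cdot> \<alpha> a ?S ?T"
    if "f \<in> hom C a b" for f a b
    using associator_natural[OF that id_hom[OF S] id_hom[OF T]] by (simp add: tensor_id S T)
  moreover have "map_arr (tensor_right C ?T) (f \<odot> id ?S) = (f \<odot> id ?S) \<odot> id ?T"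
    if "f \<in> hom C a b" for f a b
    using tensor_hom[OF that id_hom[OF S]] by (rule tensor_right_simps)
  moreover have "comp_functor C (tensor_right C ?T) (tensor_right C ?S) \<in> Obj (endofunctors C)"
    "tensor_right C (?S \<otimes> ?T) \<in> Obj (endofunctors C)"
    using S T by (auto intro: comp_functor_Obj tensor_right_Obj tensor_Obj)
  ultimately show ?thesis
    using S T
    by (auto simp: hom_functor_category restriction_mult_def comp_functor_def tensor_right_simps
        tensor_Obj associator_hom hom_Arr hom_Dom_Obj hom_Cod_Obj)
qed

text \<open>
  Evaluated at \<open>X\<close>, the graded monad laws turn into coherence conditions of \<open>C\<close> whose first argument is
  \<open>X\<close>:  naturality of \<open>\<mu>\<close> in its indices is naturality of \<open>\<alpha>\<close> at \<open>id X, f, g\<close>, associativity is the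
  pentagon for \<open>X, R, S, T\<close>, and the unit laws are the triangle for \<open>X, S\<close> and Kelly's formula for
  \<open>\<rho> (X \<otimes> S)\<close>.
\<close>

lemma restriction_graded_monad:
  "graded_monad E C (restriction C) restriction_unit restriction_mult"
proof (intro graded_monad.intro graded_monad_axioms.intro)
  show "monoidal_category E" by (rule monoidal_category_subunits)
  show "category C" by (rule category_axioms)
  show "cat_functor E (endofunctors C) (restriction C)" by (rule restriction_functor)
  show "restriction_unit \<in> hom (endofunctors C) (id_functor C) (map_obj (restriction C) \<I>\<^bsub>E\<^esub>)"
    using restriction_unit_hom by (simp add: restriction_obj subunits_simps Dom_id unit_Obj)
next
  fix s t assume "s \<in> Obj E" "t \<in> Obj E"
  then show "restriction_mult s t \<in> hom (endofunctors C)
      (comp_functor C (map_obj (restriction C) t) (map_obj (restriction C) s))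
      (map_obj (restriction C) (s \<otimes>\<^bsub>E\<^esub> t))"
    using restriction_mult_hom
    by (simp add: Obj_subunits restriction_obj subunits_simps Dom_tensor_subunit)
next
  fix p q s s' t t' X
  assume "p \<in> hom E s s'" "q \<in> hom E t t'" and X: "X \<in> Obj C"
  then obtain f g where p: "p = (s, f, s')" and q: "q = (t, g, t')"
    and f: "f \<in> hom C (Dom C s) (Dom C s')" and g: "g \<in> hom C (Dom C t) (Dom C t')"
    by (auto simp: hom_subunits)
  note S' = hom_Cod_Obj[OF f] and T = hom_Dom_Obj[OF g]
  have Xf: "id X \<odot> f \<in> hom C (X \<otimes> Dom C s) (X \<otimes> Dom C s')"
    by (rule hom_intros X f)+
  have "(id X \<odot> (f \<odot> g)) \<cdot> \<alpha> X (Dom C s) (Dom C t)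
      = \<alpha> X (Dom C s') (Dom C t') \<cdot> ((id X \<odot> f) \<odot> g)"
    by (rule associator_natural[OF id_hom[OF X] f g, symmetric])
  also have "(id X \<odot> f) \<odot> g = (id (X \<otimes> Dom C s') \<odot> g) \<cdot> ((id X \<odot> f) \<odot> id (Dom C t))"
    by (rule tensor_split(1)[OF Xf g, symmetric])
  finally show "component (map_arr (restriction C) (p \<odot>\<^bsub>E\<^esub> q)) X \<cdot> component (restriction_mult s t) X
      = component (restriction_mult s' t') X \<cdot>
        component (map_arr (restriction C) q) (map_obj (map_obj (restriction C) s') X) \<cdot>
        map_arr (map_obj (restriction C) t) (component (map_arr (restriction C) p) X)"
    using X S' tensor_right_simps(2)[OF Xf]
    by (simp add: p q subunits_simps restriction_arr restriction_obj restriction_mult_def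
        tensor_right_simps tensor_Obj)
next
  fix r s t X assume "r \<in> Obj E" "s \<in> Obj E" "t \<in> Obj E" and X: "X \<in> Obj C"
  then have rst: "idempotent_subunit C r" "idempotent_subunit C s" "idempotent_subunit C t"
    by (simp_all add: Obj_subunits)
  note RST = rst[THEN subunit_Dom_Obj]
  show "component (map_arr (restriction C) (\<alpha>\<^bsub>E\<^esub> r s t)) X \<cdot>
        component (restriction_mult (r \<otimes>\<^bsub>E\<^esub> s) t) X \<cdot>
        map_arr (map_obj (restriction C) t) (component (restriction_mult r s) X)
      = component (restriction_mult r (s \<otimes>\<^bsub>E\<^esub> t)) X \<cdot>
        component (restriction_mult s t) (map_obj (map_obj (restriction C) r) X)"
    using X rst RST pentagon[OF X RST] tensor_right_simps(2)[OF associator_hom[OF X RST(1,2)]]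
    by (simp add: subunits_simps restriction_arr restriction_obj restriction_mult_def
        tensor_right_simps tensor_Obj Dom_tensor_subunit)
next
  fix s X assume "s \<in> Obj E" and X: "X \<in> Obj C"
  then have S: "Dom C s \<in> Obj C"
    by (simp add: Obj_subunits subunit_Dom_Obj)
  let ?S = "Dom C s"
  have XS: "X \<otimes> ?S \<in> Obj C"
    using X S by (rule tensor_Obj)
  have \<alpha>: "\<alpha> X \<I> ?S \<in> hom C ((X \<otimes> \<I>) \<otimes> ?S) (X \<otimes> (\<I> \<otimes> ?S))"
    and \<alpha>': "\<alpha> X ?S \<I> \<in> hom C ((X \<otimes> ?S) \<otimes> \<I>) (X \<otimes> (?S \<otimes> \<I>))"
    and l: "id X \<odot> \<l> ?S \<in> hom C (X \<otimes> (\<I> \<otimes> ?S)) (X \<otimes> ?S)"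
    and r: "id X \<odot> \<rho> ?S \<in> hom C (X \<otimes> (?S \<otimes> \<I>)) (X \<otimes> ?S)"
    by (rule hom_intros X S)+
  have \<eta>: "runitor_inv X \<odot> id ?S \<in> hom C (X \<otimes> ?S) ((X \<otimes> \<I>) \<otimes> ?S)"
    by (rule tensor_hom[OF runitor_inv(1)[OF X] id_hom[OF S]])
  have "(id X \<odot> \<l> ?S) \<cdot> \<alpha> X \<I> ?S \<cdot> (runitor_inv X \<odot> id ?S)
      = (\<rho> X \<odot> id ?S) \<cdot> (runitor_inv X \<odot> id ?S)"
    using comp_assoc[OF \<eta> \<alpha> l] triangle[OF X S] by simp
  also have "\<dots> = id (X \<otimes> ?S)"
    using tensor_comp_id_right[OF runitor_inv(1)[OF X] runitor_hom[OF X] S]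
    by (simp add: runitor_inv X S tensor_id)
  finally show "component (map_arr (restriction C) (\<l>\<^bsub>E\<^esub> s)) X \<cdot>
        component (restriction_mult \<I>\<^bsub>E\<^esub> s) X \<cdot>
        map_arr (map_obj (restriction C) s) (component restriction_unit X)
      = id (map_obj (map_obj (restriction C) s) X)"
    using X tensor_right_simps(2)[OF runitor_inv(1)[OF X]]
    by (simp add: subunits_simps restriction_arr restriction_obj restriction_mult_def
        restriction_unit_def tensor_right_simps Dom_id unit_Obj)
  have "(id X \<odot> \<rho> ?S) \<cdot> \<alpha> X ?S \<I> \<cdot> runitor_inv (X \<otimes> ?S) = \<rho> (X \<otimes> ?S) \<cdot> runitor_inv (X \<otimes> ?S)"
    using comp_assoc[OF runitor_inv(1)[OF XS] \<alpha>' r] runitor_tensor[OF X S] by simp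
  also have "\<dots> = id (X \<otimes> ?S)"
    by (rule runitor_inv(3)[OF XS])
  finally show "component (map_arr (restriction C) (\<rho>\<^bsub>E\<^esub> s)) X \<cdot>
        component (restriction_mult s \<I>\<^bsub>E\<^esub>) X \<cdot>
        component restriction_unit (map_obj (map_obj (restriction C) s) X)
      = id (map_obj (map_obj (restriction C) s) X)"
    using X XS
    by (simp add: subunits_simps restriction_arr restriction_obj restriction_mult_def
        restriction_unit_def tensor_right_simps Dom_id unit_Obj)
qed

end

theorem theorem19:
  fixes C :: "('o, 'a) moncat"
  assumes "monoidal_category C"
    and "\<And>s t. idempotent_subunit C s \<Longrightarrow> idempotent_subunit C t
      \<Longrightarrow> idempotent_subunit C (tensor_subunit C s t)"
  shows "\<exists>\<eta> \<mu>. graded_monad (idempotent_subunits C) C (restriction C) \<eta> \<mu>"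
proof -
  interpret tensor_closed_subunits C
    by (intro tensor_closed_subunits.intro tensor_closed_subunits_axioms.intro assms)
  show ?thesis
    using restriction_graded_monad by blast
qed

end
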